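(* Let $G$ be a semigroup. Then a subset of $G$ has a minimal Furstenberg system if and only if it is strongly dynamically syndetic.
   Context: Semigroups are discrete and contain an identity element $e$ (an artificial one is added if necessary). A topological dynamical $G$-system $(X,(T_g)_{g\in G})$ is a compact Hausdorff space $X$ with continuous maps $T_g:X\to X$ such that $T_{gh}=T_gT_h$ for all $g,h\in G$ and $T_e=\mathrm{id}_X$. A point $a\in X$ is transitive if $\{T_ga:g\in G\}$ is dense in $X$; the system is minimal if all its points are transitive. For bounded $f:G\to\mathbb{C}$, a $G$-system $(X,(T_g)_{g\in G})$ is a Furstenberg system of $f$ if (i) there exist $F\in C(X)$ and a transitive point $a\in X$ with $f(g)=F(T_ga)$ for all $g\in G$, and (ii) for any $x\ne y$ in $X$ there is $g\in G$ with $F(T_gx)\neq F(T_gy)$. It is unique up to topological isomorphism (equivariant homeomorphism), one realisation being the orbit closure of $f$ in $\overline{f(G)}^G$ (product topology) under the right shift $R_g\big((x(u))_{u\in G}\big)=(x(ug))_{u\in G}$. The Furstenberg system of a set $A\subset G$ is that of its indicator function $\mathbb{1}_A:G\to\{0,1\}$. A set $H\subset G$ is strongly dynamically syndetic if it can be written as $H=\{g\in G:T_ga\in U\}$, where $(X,(T_g)_{g\in G})$ is a minimal $G$-system, $a\in X$, $U\subset X$ is some non-empty open set, and, in addition, the set $\{g\in G:T_ga\in\overline{U}\setminus U\}$ is empty.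
   Formalization: The subset is assumed non-empty: the empty set has the one-point system as its minimal Furstenberg system, but is not strongly dynamically syndetic, because U must be non-empty and every orbit in a minimal system meets U. *)

theory Defs
  imports "HOL-Analysis.Analysis"
begin

text \<open>
  The acting semigroup with identity is a type of class \<open>monoid_mult\<close>. A system consists of a
  topology \<open>X\<close>, whose underlying space is \<^term>\<open>topspace X\<close>, and maps \<open>T g\<close>, of which only
  the values on \<^term>\<open>topspace X\<close> matter.
\<close>

definition dynamical_system ::
    "'x topology \<Rightarrow> ('g::monoid_mult \<Rightarrow> 'x \<Rightarrow> 'x) \<Rightarrow> bool" where
  "dynamical_system X T \<longleftrightarrow>
     compact_space X \<and> Hausdorff_space X \<and>
     (\<forall>g. continuous_map X X (T g)) \<and>
     (\<forall>g h. \<forall>x\<in>topspace X. T (g * h) x = T g (T h x)) \<and>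
     (\<forall>x\<in>topspace X. T 1 x = x)"

definition transitive_point ::
    "'x topology \<Rightarrow> ('g::monoid_mult \<Rightarrow> 'x \<Rightarrow> 'x) \<Rightarrow> 'x \<Rightarrow> bool" where
  "transitive_point X T a \<longleftrightarrow>
     a \<in> topspace X \<and> X closure_of (range (\<lambda>g. T g a)) = topspace X"

definition minimal_system ::
    "'x topology \<Rightarrow> ('g::monoid_mult \<Rightarrow> 'x \<Rightarrow> 'x) \<Rightarrow> bool" where
  "minimal_system X T \<longleftrightarrow>
     dynamical_system X T \<and> (\<forall>x\<in>topspace X. transitive_point X T x)"

definition furstenberg_system ::
    "('g::monoid_mult \<Rightarrow> complex) \<Rightarrow> 'x topology \<Rightarrow> ('g \<Rightarrow> 'x \<Rightarrow> 'x) \<Rightarrow> bool" where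
  "furstenberg_system f X T \<longleftrightarrow>
     bounded (range f) \<and> dynamical_system X T \<and>
     (\<exists>F a. continuous_map X euclidean F \<and> transitive_point X T a \<and>
            (\<forall>g. f g = F (T g a)) \<and>
            (\<forall>x\<in>topspace X. \<forall>y\<in>topspace X. x \<noteq> y \<longrightarrow> (\<exists>g. F (T g x) \<noteq> F (T g y))))"

definition minimal_furstenberg_system_of_set ::
    "'g::monoid_mult set \<Rightarrow> 'x topology \<Rightarrow> ('g \<Rightarrow> 'x \<Rightarrow> 'x) \<Rightarrow> bool" where
  "minimal_furstenberg_system_of_set A X T \<longleftrightarrow>
     furstenberg_system (indicator A) X T \<and> minimal_system X T"

definition strongly_dynamically_syndetic_via ::
    "'g::monoid_mult set \<Rightarrow> 'x topology \<Rightarrow> ('g \<Rightarrow> 'x \<Rightarrow> 'x) \<Rightarrow> bool" where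
  "strongly_dynamically_syndetic_via H X T \<longleftrightarrow>
     minimal_system X T \<and>
     (\<exists>a\<in>topspace X. \<exists>U. openin X U \<and> U \<noteq> {} \<and> H = {g. T g a \<in> U} \<and>
        {g. T g a \<in> X closure_of U - U} = {})"

text \<open>
  HOL has no quantifier over types, so ``there is a system'' needs one type of points.
  The type \<open>'g set set\<close> is large enough to lose nothing: a compact Hausdorff space with
  a transitive point \<open>a\<close> injects into it by sending \<open>x\<close> to the collection of all \<open>S\<close> for which
  \<open>x\<close> lies in the closure of \<open>{T g a | g \<in> S}\<close>. The lemmas
  \<open>has_minimal_furstenberg_systemI\<close> and \<open>strongly_dynamically_syndeticI\<close> below show that
  a witness with points of an arbitrary type suffices for the two notions defined here.
\<close>

definition has_minimal_furstenberg_system :: "'g::monoid_mult set \<Rightarrow> bool" where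
  "has_minimal_furstenberg_system A \<longleftrightarrow>
     (\<exists>(X :: 'g set set topology) T. minimal_furstenberg_system_of_set A X T)"

definition strongly_dynamically_syndetic :: "'g::monoid_mult set \<Rightarrow> bool" where
  "strongly_dynamically_syndetic H \<longleftrightarrow>
     (\<exists>(X :: 'g set set topology) T. strongly_dynamically_syndetic_via H X T)"


definition system_iso ::
    "'x topology \<Rightarrow> ('g::monoid_mult \<Rightarrow> 'x \<Rightarrow> 'x) \<Rightarrow>
     'y topology \<Rightarrow> ('g \<Rightarrow> 'y \<Rightarrow> 'y) \<Rightarrow> ('x \<Rightarrow> 'y) \<Rightarrow> bool" where
  "system_iso X T Y S p \<longleftrightarrow>
     homeomorphic_map X Y p \<and> (\<forall>g. \<forall>x\<in>topspace X. p (T g x) = S g (p x))"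

lemma dynamical_system_maps:
  "dynamical_system X T \<Longrightarrow> x \<in> topspace X \<Longrightarrow> T g x \<in> topspace X"
  by (auto simp: dynamical_system_def continuous_map_def)

lemma transitive_system_embeds:
  fixes T :: "'g::monoid_mult \<Rightarrow> 'x \<Rightarrow> 'x"
  assumes "dynamical_system X T" and "transitive_point X T a"
  shows "\<exists>p :: 'x \<Rightarrow> 'g set set. inj_on p (topspace X)"
proof -
  define p where "p x = {S. x \<in> X closure_of ((\<lambda>g. T g a) ` S)}" for x
  have "inj_on p (topspace X)"
  proof (rule inj_onI, rule ccontr)
    fix x y assume x: "x \<in> topspace X" and y: "y \<in> topspace X" and eq: "p x = p y" and "x \<noteq> y"
    then obtain U V where UV: "openin X U" "openin X V" "x \<in> U" "y \<in> V" "disjnt U V"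
      using assms(1) unfolding dynamical_system_def Hausdorff_space_def by metis
    define S where "S = {g. T g a \<in> U}"
    have dense: "X closure_of (range (\<lambda>g. T g a)) = topspace X"
      using assms(2) by (simp add: transitive_point_def)
    have "x \<in> X closure_of ((\<lambda>g. T g a) ` S)"
      unfolding in_closure_of
    proof (intro conjI x allI impI)
      fix W assume "x \<in> W \<and> openin X W"
      then have W: "x \<in> W \<inter> U" "openin X (W \<inter> U)" using UV by auto
      have "x \<in> X closure_of (range (\<lambda>g. T g a))" using dense x by simp
      then obtain g where "T g a \<in> W \<inter> U" using W unfolding in_closure_of by blast
      then show "\<exists>y. y \<in> (\<lambda>g. T g a) ` S \<and> y \<in> W" by (auto simp: S_def)
    qed
    then have "S \<in> p y" using eq by (auto simp: p_def)
    then have "\<exists>z. z \<in> (\<lambda>g. T g a) ` S \<and> z \<in> V"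
      using UV unfolding p_def in_closure_of by blast
    then show False using UV(5) by (auto simp: S_def disjnt_iff)
  qed
  then show ?thesis by blast
qed

lemma system_iso_ex:
  fixes T :: "'g::monoid_mult \<Rightarrow> 'x \<Rightarrow> 'x" and p :: "'x \<Rightarrow> 'y"
  assumes X: "dynamical_system X T" and inj: "inj_on p (topspace X)"
  shows "\<exists>Y S. system_iso X T Y S p"
proof -
  define q where "q = inv_into (topspace X) p"
  define Y where "Y = pullback_topology (p ` topspace X) q X"
  define S where "S g y = p (T g (q y))" for g y
  have qp: "q (p x) = x" if "x \<in> topspace X" for x
    using inj that by (simp add: q_def)
  have pq: "p (q y) = y" "q y \<in> topspace X" if "y \<in> p ` topspace X" for y
    using that by (auto simp: q_def f_inv_into_f inv_into_into)
  have topY: "topspace Y = p ` topspace X"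
    unfolding Y_def topspace_pullback_topology using pq by auto
  have "continuous_map X Y p"
    unfolding continuous_map_def topY
  proof (intro conjI allI impI)
    fix V assume "openin Y V"
    then obtain U where U: "openin X U" "V = q -` U \<inter> p ` topspace X"
      by (auto simp: Y_def openin_pullback_topology)
    then have "{x \<in> topspace X. p x \<in> V} = U"
      using qp openin_subset[OF U(1)] by force
    then show "openin X {x \<in> topspace X. p x \<in> V}" using U by simp
  qed auto
  moreover have "continuous_map Y X q"
    unfolding continuous_map_def
  proof (intro conjI allI impI)
    show "q \<in> topspace Y \<rightarrow> topspace X" using topY pq by auto
    fix U assume "openin X U"
    then show "openin Y {x \<in> topspace Y. q x \<in> U}"
      unfolding topY unfolding Y_def openin_pullback_topology by blast
  qed
  ultimately have "homeomorphic_maps X Y p q"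
    using qp pq topY by (simp add: homeomorphic_maps_def)
  then have "system_iso X T Y S p"
    unfolding system_iso_def S_def using homeomorphic_map_maps qp by fastforce
  then show ?thesis by blast
qed

lemma dynamical_system_iso:
  assumes iso: "system_iso X T Y S p" and X: "dynamical_system X T"
  shows "dynamical_system Y S"
proof -
  have hom: "homeomorphic_map X Y p" and eqv: "\<And>g x. x \<in> topspace X \<Longrightarrow> S g (p x) = p (T g x)"
    using iso by (auto simp: system_iso_def)
  obtain q where q: "homeomorphic_maps X Y p q" using hom homeomorphic_map_maps by blast
  have Y: "topspace Y = p ` topspace X" using hom homeomorphic_imp_surjective_map by blast
  have "X homeomorphic_space Y" using q by (auto simp: homeomorphic_space_def)
  then have "compact_space Y" "Hausdorff_space Y"
    using X homeomorphic_compact_space homeomorphic_Hausdorff_space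
    by (auto simp: dynamical_system_def)
  moreover have "continuous_map Y Y (S g)" for g
  proof -
    have "continuous_map Y Y (p \<circ> T g \<circ> q)"
      using q X unfolding homeomorphic_maps_def dynamical_system_def
      by (meson continuous_map_compose)
    moreover have "(p \<circ> T g \<circ> q) y = S g y" if "y \<in> topspace Y" for y
      using that q eqv Y by (auto simp: homeomorphic_maps_def)
    ultimately show ?thesis by (rule continuous_map_eq)
  qed
  ultimately show ?thesis
    using X eqv Y dynamical_system_maps[OF X] by (auto simp: dynamical_system_def)
qed

lemma transitive_point_iso:
  assumes iso: "system_iso X T Y S p" and X: "dynamical_system X T"
    and a: "transitive_point X T a"
  shows "transitive_point Y S (p a)"
proof -
  have hom: "homeomorphic_map X Y p" and eqv: "\<And>g x. x \<in> topspace X \<Longrightarrow> S g (p x) = p (T g x)"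
    using iso by (auto simp: system_iso_def)
  have Y: "topspace Y = p ` topspace X" using hom homeomorphic_imp_surjective_map by blast
  have aX: "a \<in> topspace X" using a by (simp add: transitive_point_def)
  have "range (\<lambda>g. T g a) \<subseteq> topspace X" using dynamical_system_maps[OF X aX] by auto
  then have "Y closure_of (p ` range (\<lambda>g. T g a)) = p ` (X closure_of range (\<lambda>g. T g a))"
    using homeomorphic_map_closure_of[OF hom] by blast
  moreover have "p ` range (\<lambda>g. T g a) = range (\<lambda>g. S g (p a))" using eqv[OF aX] by auto
  ultimately show ?thesis using a Y by (auto simp: transitive_point_def)
qed

lemma minimal_system_iso:
  assumes "system_iso X T Y S p" and "minimal_system X T"
  shows "minimal_system Y S"
proof -
  have "topspace Y = p ` topspace X"
    using assms(1) homeomorphic_imp_surjective_map unfolding system_iso_def by blast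
  then show ?thesis
    using assms dynamical_system_iso[OF assms(1)] transitive_point_iso[OF assms(1)]
    by (auto simp: minimal_system_def)
qed

lemma furstenberg_system_iso:
  assumes iso: "system_iso X T Y S p" and f: "furstenberg_system f X T"
  shows "furstenberg_system f Y S"
proof -
  have hom: "homeomorphic_map X Y p" and eqv: "\<And>g x. x \<in> topspace X \<Longrightarrow> S g (p x) = p (T g x)"
    using iso by (auto simp: system_iso_def)
  obtain q where q: "homeomorphic_maps X Y p q" using hom homeomorphic_map_maps by blast
  have qp: "\<And>x. x \<in> topspace X \<Longrightarrow> q (p x) = x" using q by (simp add: homeomorphic_maps_def)
  have Y: "topspace Y = p ` topspace X" using hom homeomorphic_imp_surjective_map by blast
  have X: "dynamical_system X T" using f by (simp add: furstenberg_system_def)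
  obtain F a where F: "continuous_map X euclidean F" and a: "transitive_point X T a"
    and val: "\<And>g. f g = F (T g a)"
    and sep: "\<And>x y. x \<in> topspace X \<Longrightarrow> y \<in> topspace X \<Longrightarrow> x \<noteq> y \<Longrightarrow> \<exists>g. F (T g x) \<noteq> F (T g y)"
    using f unfolding furstenberg_system_def by metis
  have aX: "a \<in> topspace X" using a by (simp add: transitive_point_def)
  have FS: "(F \<circ> q) (S g (p x)) = F (T g x)" if "x \<in> topspace X" for g x
    using that eqv qp dynamical_system_maps[OF X] by simp
  have "continuous_map Y euclidean (F \<circ> q)"
    using q F by (auto simp: homeomorphic_maps_def intro: continuous_map_compose)
  moreover have "\<forall>g. f g = (F \<circ> q) (S g (p a))" using val FS aX by metis
  moreover have "\<forall>x\<in>topspace Y. \<forall>y\<in>topspace Y. x \<noteq> y \<longrightarrow>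
      (\<exists>g. (F \<circ> q) (S g x) \<noteq> (F \<circ> q) (S g y))"
  proof (intro ballI impI)
    fix x y assume "x \<in> topspace Y" "y \<in> topspace Y" "x \<noteq> y"
    then obtain u v where "x = p u" "y = p v" "u \<in> topspace X" "v \<in> topspace X" "u \<noteq> v"
      using Y by auto
    then show "\<exists>g. (F \<circ> q) (S g x) \<noteq> (F \<circ> q) (S g y)" using sep FS by metis
  qed
  ultimately show ?thesis
    using f dynamical_system_iso[OF iso X] transitive_point_iso[OF iso X a]
    unfolding furstenberg_system_def by blast
qed

lemma strongly_dynamically_syndetic_via_iso:
  assumes iso: "system_iso X T Y S p" and H: "strongly_dynamically_syndetic_via H X T"
  shows "strongly_dynamically_syndetic_via H Y S"
proof -
  have hom: "homeomorphic_map X Y p" and eqv: "\<And>g x. x \<in> topspace X \<Longrightarrow> S g (p x) = p (T g x)"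
    using iso by (auto simp: system_iso_def)
  have inj: "inj_on p (topspace X)" using hom homeomorphic_imp_injective_map by blast
  have Y: "topspace Y = p ` topspace X" using hom homeomorphic_imp_surjective_map by blast
  have X: "minimal_system X T" using H by (simp add: strongly_dynamically_syndetic_via_def)
  obtain a U where aX: "a \<in> topspace X" and U: "openin X U" "U \<noteq> {}" and
    HU: "H = {g. T g a \<in> U}" "{g. T g a \<in> X closure_of U - U} = {}"
    using H unfolding strongly_dynamically_syndetic_via_def by blast
  have sub: "U \<subseteq> topspace X" using U(1) by (rule openin_subset)
  have Ta: "T g a \<in> topspace X" for g
    using X aX dynamical_system_maps by (auto simp: minimal_system_def)
  have cl: "Y closure_of (p ` U) = p ` (X closure_of U)"
    using homeomorphic_map_closure_of[OF hom sub] .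
  have mem: "S g (p a) \<in> p ` B \<longleftrightarrow> T g a \<in> B" if "B \<subseteq> topspace X" for g B
    using inj_on_image_mem_iff[OF inj Ta that] eqv[OF aX] by simp
  have "openin Y (p ` U)" using homeomorphic_map_openness[OF hom sub] U(1) by blast
  moreover have "H = {g. S g (p a) \<in> p ` U}" using HU(1) mem[OF sub] by simp
  moreover have "{g. S g (p a) \<in> Y closure_of (p ` U) - p ` U} = {}"
    using HU(2) mem[OF sub] mem[OF closure_of_subset_topspace] by (simp add: cl)
  ultimately show ?thesis
    using minimal_system_iso[OF iso X] aX Y U(2)
    unfolding strongly_dynamically_syndetic_via_def by blast
qed

lemma has_minimal_furstenberg_systemI:
  fixes X :: "'x topology"
  assumes "minimal_furstenberg_system_of_set A X T"
  shows "has_minimal_furstenberg_system A"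
proof -
  have "dynamical_system X T" "\<exists>a. transitive_point X T a"
    using assms by (auto simp: minimal_furstenberg_system_of_set_def furstenberg_system_def)
  then show ?thesis
    using assms transitive_system_embeds system_iso_ex furstenberg_system_iso minimal_system_iso
    unfolding has_minimal_furstenberg_system_def minimal_furstenberg_system_of_set_def by metis
qed

lemma strongly_dynamically_syndeticI:
  fixes X :: "'x topology"
  assumes "strongly_dynamically_syndetic_via H X T"
  shows "strongly_dynamically_syndetic H"
proof -
  have "dynamical_system X T" "\<exists>a. transitive_point X T a"
    using assms by (auto simp: strongly_dynamically_syndetic_via_def minimal_system_def)
  then show ?thesis
    using assms transitive_system_embeds system_iso_ex strongly_dynamically_syndetic_via_iso
    unfolding strongly_dynamically_syndetic_def by metis
qed

text \<open>
  The empty set has the one-point system as a minimal Furstenberg system, but it is not strongly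
  dynamically syndetic: an orbit in a minimal system meets every non-empty open set.
\<close>

lemma has_minimal_furstenberg_system_empty:
  "has_minimal_furstenberg_system ({} :: 'g::monoid_mult set)"
proof (rule has_minimal_furstenberg_systemI)
  let ?X = "discrete_topology (UNIV :: unit set)"
  let ?T = "\<lambda>(g::'g) (x::unit). x"
  have sys: "dynamical_system ?X ?T"
    by (auto simp: dynamical_system_def compact_space_discrete_topology)
  moreover have tr: "transitive_point ?X ?T x" for x
    by (simp add: transitive_point_def discrete_topology_closure_of UNIV_unit)
  moreover have "furstenberg_system (indicator {}) ?X ?T"
    unfolding furstenberg_system_def
  proof (intro conjI sys)
    show "\<exists>F a. continuous_map ?X euclidean F \<and> transitive_point ?X ?T a \<and>
        (\<forall>g. indicator {} g = (F (?T g a) :: complex)) \<and>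
        (\<forall>x\<in>topspace ?X. \<forall>y\<in>topspace ?X. x \<noteq> y \<longrightarrow> (\<exists>g. F (?T g x) \<noteq> F (?T g y)))"
      by (rule exI[of _ "\<lambda>_. 0"], rule exI[of _ "()"]) (use tr[of "()"] in simp)
  qed simp
  ultimately show "minimal_furstenberg_system_of_set {} ?X ?T"
    by (simp add: minimal_furstenberg_system_of_set_def minimal_system_def)
qed

lemma not_strongly_dynamically_syndetic_empty:
  "\<not> strongly_dynamically_syndetic ({} :: 'g::monoid_mult set)"
proof
  assume "strongly_dynamically_syndetic ({} :: 'g set)"
  then obtain X :: "'g set set topology" and T :: "'g \<Rightarrow> 'g set set \<Rightarrow> 'g set set"
    where "strongly_dynamically_syndetic_via {} X T"
    unfolding strongly_dynamically_syndetic_def by blast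
  then obtain a U where "minimal_system X T" "a \<in> topspace X" "openin X U" "U \<noteq> {}"
    and e: "{} = {g. T g a \<in> U}"
    unfolding strongly_dynamically_syndetic_via_def by blast
  then have "X closure_of (range (\<lambda>g. T g a)) = topspace X"
    by (auto simp: minimal_system_def transitive_point_def)
  then have "U \<inter> range (\<lambda>g. T g a) \<noteq> {}"
    using dense_intersects_open[of X "range (\<lambda>g. T g a)"] \<open>openin X U\<close> \<open>U \<noteq> {}\<close>
    by (simp add: Int_commute)
  then show False using e by auto
qed

end

theory Submission
  imports Defs
begin

text \<open>
  If \<open>F\<close> realises \<open>\<one>\<^sub>A\<close> on a system with transitive point \<open>a\<close>, then \<open>F\<close> is \<open>{0,1}\<close>-valued by
  density, so \<open>F = 1\<close> defines a clopen set witnessing strong dynamical syndeticity. Conversely,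
  let \<open>A = {g. T g a \<in> U}\<close> with no orbit point on the boundary of \<open>U\<close>, and let \<open>y\<close> be in the orbit
  closure of \<open>\<one>\<^sub>A\<close> under the right shift. By compactness \<open>(x, y)\<close> is a limit of pairs
  \<open>(T g a, R g \<one>\<^sub>A)\<close> for some \<open>x\<close>. As \<open>X\<close> is minimal, some \<open>T h x\<close> is close to \<open>a\<close>; since every
  \<open>T u a\<close> lies in \<open>U\<close> or in the exterior of \<open>U\<close>, this forces \<open>R h y\<close> to agree with \<open>\<one>\<^sub>A\<close> on any
  prescribed finite set. Hence \<open>\<one>\<^sub>A\<close> lies in the orbit closure of each such \<open>y\<close>, which is minimality.
\<close>

section \<open>Orbit closures as subsystems\<close>

lemma orbit_closure_invariant:
  assumes X: "dynamical_system X T" and a: "a \<in> topspace X"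
    and x: "x \<in> X closure_of (range (\<lambda>g. T g a))"
  shows "T h x \<in> X closure_of (range (\<lambda>g. T g a))"
proof -
  have "T h ` (X closure_of (range (\<lambda>g. T g a))) \<subseteq> X closure_of (T h ` range (\<lambda>g. T g a))"
    using X by (intro continuous_map_image_closure_subset) (auto simp: dynamical_system_def)
  also have "T h ` range (\<lambda>g. T g a) = range (\<lambda>g. T (h * g) a)"
    using X a by (auto simp: dynamical_system_def image_image)
  also have "X closure_of (range (\<lambda>g. T (h * g) a)) \<subseteq> X closure_of (range (\<lambda>g. T g a))"
    by (intro closure_of_mono) auto
  finally show ?thesis using x by auto
qed

lemma orbit_closure_system:
  fixes X :: "'x topology" and T :: "'g::monoid_mult \<Rightarrow> 'x \<Rightarrow> 'x"
  assumes X: "dynamical_system X T" and a: "a \<in> topspace X"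
  defines "Y \<equiv> subtopology X (X closure_of (range (\<lambda>g. T g a)))"
  shows "dynamical_system Y T" and "transitive_point Y T a"
proof -
  let ?C = "X closure_of (range (\<lambda>g. T g a))"
  have C: "?C \<subseteq> topspace X" by (rule closure_of_subset_topspace)
  then have top: "topspace Y = ?C" by (auto simp: Y_def)
  have orb: "range (\<lambda>g. T g a) \<subseteq> ?C"
    using dynamical_system_maps[OF X a] by (intro closure_of_subset) auto
  have "compact_space Y"
    unfolding Y_def using X
    by (intro compact_space_subtopology closedin_compact_space) (auto simp: dynamical_system_def)
  moreover have "Hausdorff_space Y"
    unfolding Y_def using X by (auto simp: dynamical_system_def intro: Hausdorff_space_subtopology)
  moreover have "continuous_map Y Y (T g)" for g
    unfolding Y_def using X orbit_closure_invariant[OF X a] C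
    by (auto simp: dynamical_system_def continuous_map_in_subtopology
        intro: continuous_map_from_subtopology)
  ultimately show "dynamical_system Y T"
    using X top C by (auto simp: dynamical_system_def)
  have "a = T 1 a" using X a by (simp add: dynamical_system_def)
  then have "a \<in> ?C" using orb by (metis rangeI subsetD)
  moreover have "Y closure_of (range (\<lambda>g. T g a)) = ?C"
    using orb by (simp add: Y_def closure_of_subtopology Int_absorb1)
  ultimately show "transitive_point Y T a"
    by (simp add: transitive_point_def top)
qed

text \<open>Every orbit closure is closed and invariant, so once it contains the transitive point
  \<open>a\<close> it contains the dense orbit of \<open>a\<close>.\<close>

lemma minimal_systemI:
  assumes X: "dynamical_system X T" and a: "transitive_point X T a"
    and rec: "\<And>x. x \<in> topspace X \<Longrightarrow> a \<in> X closure_of (range (\<lambda>g. T g x))"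
  shows "minimal_system X T"
  unfolding minimal_system_def transitive_point_def
proof (intro conjI X ballI)
  fix x assume x: "x \<in> topspace X"
  let ?C = "X closure_of (range (\<lambda>g. T g x))"
  have "range (\<lambda>g. T g a) \<subseteq> ?C"
    using orbit_closure_invariant[OF X x rec[OF x]] by auto
  then have "X closure_of (range (\<lambda>g. T g a)) \<subseteq> ?C"
    by (intro closure_of_minimal) auto
  then show "?C = topspace X"
    using a closure_of_subset_topspace[of X] by (auto simp: transitive_point_def)
qed auto

section \<open>The shift and the Furstenberg system of a set\<close>

definition shift_topology :: "('g \<Rightarrow> bool) topology" where
  "shift_topology = product_topology (\<lambda>_. discrete_topology UNIV) UNIV"

text \<open>Multiplying the argument on the right gives a left action: both
  \<open>shift g (shift h y)\<close> and \<open>shift (g * h) y\<close> send \<open>u\<close> to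
  \<open>y (u * g * h)\<close>.\<close>

definition shift :: "'g::monoid_mult \<Rightarrow> ('g \<Rightarrow> bool) \<Rightarrow> 'g \<Rightarrow> bool" where
  "shift g y = (\<lambda>u. y (u * g))"

lemma topspace_shift_topology [simp]: "topspace shift_topology = UNIV"
  by (simp add: shift_topology_def)

lemma continuous_map_shift_topology_proj:
  "continuous_map shift_topology (discrete_topology UNIV) (\<lambda>y. y u)"
  unfolding shift_topology_def by (rule continuous_map_product_projection) simp

text \<open>A basic open box of the product restricts only finitely many coordinates; these form
  \<open>K\<close>.\<close>

lemma openin_shift_topology_finite:
  assumes "openin shift_topology W" and "y \<in> W"
  obtains K where "finite K" and "\<And>z. (\<And>u. u \<in> K \<Longrightarrow> z u = y u) \<Longrightarrow> z \<in> W"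
proof -
  obtain V where V: "finite {i. V i \<noteq> UNIV}" "y \<in> Pi\<^sub>E UNIV V" "Pi\<^sub>E UNIV V \<subseteq> W"
    using assms unfolding shift_topology_def openin_product_topology_alt by auto
  have "z \<in> W" if z: "\<And>u. u \<in> {i. V i \<noteq> UNIV} \<Longrightarrow> z u = y u" for z
  proof -
    have "z u \<in> V u" for u
      using z[of u] V(2) by (cases "V u = UNIV") (auto simp: PiE_iff)
    then show ?thesis using V(3) by (auto simp: PiE_iff)
  qed
  then show ?thesis using V(1) that by blast
qed

lemma dynamical_system_shift:
  "dynamical_system shift_topology (shift :: 'g::monoid_mult \<Rightarrow> _)"
  unfolding dynamical_system_def
proof (intro conjI allI ballI)
  show "compact_space (shift_topology :: ('g \<Rightarrow> bool) topology)"
    by (simp add: shift_topology_def compact_space_product_topology compact_space_discrete_topology)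
  show "Hausdorff_space (shift_topology :: ('g \<Rightarrow> bool) topology)"
    by (simp add: shift_topology_def Hausdorff_space_product_topology)
  show "continuous_map shift_topology shift_topology (shift g)" for g :: 'g
    unfolding shift_topology_def continuous_map_componentwise_UNIV shift_def
    by (intro allI continuous_map_shift_topology_proj[unfolded shift_topology_def])
qed (auto simp: shift_def mult.assoc)

text \<open>The function \<open>?F\<close> reads the coordinate at the identity. As
  \<open>shift g y 1 = y g\<close>, the translates of \<open>?F\<close> recover every coordinate and
  so separate points.\<close>

lemma furstenberg_system_shift:
  fixes A :: "'g::monoid_mult set"
  defines "y0 \<equiv> (\<lambda>u. u \<in> A)"
  shows "furstenberg_system (indicator A)
    (subtopology shift_topology (shift_topology closure_of (range (\<lambda>g. shift g y0)))) shift"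
    (is "furstenberg_system _ ?Y _")
  unfolding furstenberg_system_def
proof (intro conjI exI)
  let ?F = "\<lambda>y :: 'g \<Rightarrow> bool. of_bool (y 1) :: complex"
  have "range (indicator A :: 'g \<Rightarrow> complex) \<subseteq> {0, 1}" by (auto simp: indicator_def)
  then show "bounded (range (indicator A :: 'g \<Rightarrow> complex))"
    by (rule bounded_subset[rotated]) simp
  show "dynamical_system ?Y shift" "transitive_point ?Y shift y0"
    using orbit_closure_system[OF dynamical_system_shift, of y0] by simp_all
  have "continuous_map shift_topology euclidean ((of_bool :: bool \<Rightarrow> complex) \<circ> (\<lambda>y :: 'g \<Rightarrow> bool. y 1))"
    by (rule continuous_map_compose[OF continuous_map_shift_topology_proj]) simp
  then show "continuous_map ?Y euclidean ?F"
    by (simp add: o_def continuous_map_from_subtopology)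
  show "\<forall>g. indicator A g = ?F (shift g y0)"
    by (simp add: shift_def y0_def indicator_def)
  show "\<forall>x\<in>topspace ?Y. \<forall>y\<in>topspace ?Y. x \<noteq> y \<longrightarrow> (\<exists>g. ?F (shift g x) \<noteq> ?F (shift g y))"
    by (auto simp: shift_def fun_eq_iff)
qed

section \<open>Joint orbit closures and recurrence\<close>

text \<open>Projection along the compact factor \<open>X\<close> is a closed map, so the image of
  the joint orbit closure is a closed set containing the orbit of \<open>b\<close>.\<close>

lemma orbit_closure_joining:
  fixes T :: "'g \<Rightarrow> 'x \<Rightarrow> 'x" and S :: "'g \<Rightarrow> 'y \<Rightarrow> 'y"
  assumes X: "compact_space X" and a: "\<And>g. T g a \<in> topspace X" and b: "\<And>g. S g b \<in> topspace Y"
    and y: "y \<in> Y closure_of (range (\<lambda>g. S g b))"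
  obtains x where "(x, y) \<in> prod_topology X Y closure_of (range (\<lambda>g. (T g a, S g b)))"
proof -
  let ?Z = "prod_topology X Y closure_of (range (\<lambda>g. (T g a, S g b)))"
  have "range (\<lambda>g. (T g a, S g b)) \<subseteq> ?Z"
    using a b by (intro closure_of_subset) auto
  then have "range (\<lambda>g. S g b) \<subseteq> snd ` ?Z" by force
  moreover have "closedin Y (snd ` ?Z)"
    using closed_map_snd[OF X, of Y] by (simp add: closed_map_def)
  ultimately have "Y closure_of (range (\<lambda>g. S g b)) \<subseteq> snd ` ?Z"
    by (rule closure_of_minimal)
  then show ?thesis using y that by force
qed

text \<open>On the joint orbit, coordinate \<open>u\<close> of the second entry records whether
  \<open>T u\<close> maps the first entry into \<open>U\<close>. This passes to limits wherever
  membership in \<open>U\<close> is locally constant, that is, off the boundary of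
  \<open>U\<close>.\<close>

lemma joining_agrees_off_boundary:
  assumes X: "dynamical_system X T" and a: "a \<in> topspace X" and U: "openin X U"
    and xy: "(x, y) \<in> prod_topology X shift_topology closure_of
      (range (\<lambda>g. (T g a, shift g (\<lambda>u. T u a \<in> U))))"
  shows "T u x \<in> U \<Longrightarrow> y u" and "T u x \<in> topspace X - X closure_of U \<Longrightarrow> \<not> y u"
proof -
  have x: "x \<in> topspace X" using xy by (auto simp: in_closure_of)
  have mult: "T u (T g a) = T (u * g) a" for g
    using X a by (simp add: dynamical_system_def)
  \<comment> \<open>The open conditions \<open>T u z \<in> V\<close> and \<open>z u = c\<close>
    define a neighbourhood of \<open>(x, y)\<close>, so some orbit pair satisfies both. The claims
    follow with \<open>V\<close> taken as \<open>U\<close> or its exterior, and \<open>c\<close> as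
    the wrong truth value.\<close>
  have disj: False
    if O: "openin X V" "T u x \<in> V" "y u = c" and no: "\<And>g. T (u * g) a \<in> V \<Longrightarrow> (T (u * g) a \<in> U) \<noteq> c"
    for V c
  proof -
    have "openin X {z \<in> topspace X. T u z \<in> V}"
      using X O(1) by (auto simp: dynamical_system_def intro: openin_continuous_map_preimage)
    moreover have "openin shift_topology {z \<in> topspace shift_topology. z u \<in> {c}}"
      by (rule openin_continuous_map_preimage[OF continuous_map_shift_topology_proj]) simp
    ultimately have "openin (prod_topology X shift_topology)
        ({z \<in> topspace X. T u z \<in> V} \<times> {z. z u = c})" (is "openin _ ?W")
      by (simp add: openin_prod_Times_iff)
    moreover have "(x, y) \<in> ?W" using O x by simp
    ultimately obtain z where "z \<in> range (\<lambda>g. (T g a, shift g (\<lambda>u. T u a \<in> U)))" "z \<in> ?W"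
      using xy unfolding in_closure_of by meson
    then obtain g where "T u (T g a) \<in> V" "shift g (\<lambda>u. T u a \<in> U) u = c"
      by auto
    then show False using no[of g] mult by (simp add: shift_def)
  qed
  show "y u" if "T u x \<in> U"
    using disj[OF U that, of False] by auto
  have "openin X (topspace X - X closure_of U)" by auto
  moreover have "U \<subseteq> X closure_of U"
    using U by (simp add: closure_of_subset openin_subset)
  ultimately show "\<not> y u" if "T u x \<in> topspace X - X closure_of U"
    using disj[of "topspace X - X closure_of U" True] that by auto
qed

lemma strongly_dynamically_syndetic_via_imp_recurrent:
  assumes X: "minimal_system X T" and a: "a \<in> topspace X" and U: "openin X U"
    and bd: "\<And>g. T g a \<notin> X closure_of U - U"
    and y: "y \<in> shift_topology closure_of (range (\<lambda>g. shift g (\<lambda>u. T u a \<in> U)))"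
  shows "(\<lambda>u. T u a \<in> U) \<in> shift_topology closure_of (range (\<lambda>g. shift g y))"
  unfolding in_closure_of
proof (intro conjI allI impI)
  have ds: "dynamical_system X T" using X by (simp add: minimal_system_def)
  fix W assume "(\<lambda>u. T u a \<in> U) \<in> W \<and> openin shift_topology W"
  then obtain K where K: "finite K" "\<And>z. (\<And>u. u \<in> K \<Longrightarrow> z u = (T u a \<in> U)) \<Longrightarrow> z \<in> W"
    using openin_shift_topology_finite[of W "\<lambda>u. T u a \<in> U"] by metis
  obtain x where xy: "(x, y) \<in> prod_topology X shift_topology closure_of
      (range (\<lambda>g. (T g a, shift g (\<lambda>u. T u a \<in> U))))"
    using orbit_closure_joining[of X T a shift "\<lambda>u. T u a \<in> U" shift_topology y]
      ds dynamical_system_maps[OF ds a] y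
    by (auto simp: dynamical_system_def)
  have x: "x \<in> topspace X" using xy by (auto simp: in_closure_of)
  \<comment> \<open>As the orbit avoids the boundary, \<open>B u\<close> is an open neighbourhood of
    \<open>T u a\<close> on which membership in \<open>U\<close> is constant.\<close>
  define B where "B u = (if T u a \<in> U then U else topspace X - X closure_of U)" for u
  \<comment> \<open>Finiteness of \<open>K\<close> keeps \<open>V\<close> open; the factor
    \<open>topspace X\<close> covers empty \<open>K\<close>, where the intersection is
    \<open>UNIV\<close>.\<close>
  define V where "V = topspace X \<inter> (\<Inter>u\<in>K. {z \<in> topspace X. T u z \<in> B u})"
  have "openin X (B u)" for u using U by (auto simp: B_def intro: openin_diff)
  then have "openin X {z \<in> topspace X. T u z \<in> B u}" for u
    using ds by (auto simp: dynamical_system_def intro: openin_continuous_map_preimage)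
  then have "openin X V"
    unfolding V_def using K(1) by (cases "K = {}") (auto intro!: openin_Inter)
  moreover have "a \<in> V"
    using a bd dynamical_system_maps[OF ds a] by (auto simp: V_def B_def)
  moreover have "a \<in> X closure_of (range (\<lambda>g. T g x))"
    using X a x by (auto simp: minimal_system_def transitive_point_def)
  ultimately obtain h where h: "T h x \<in> V" unfolding in_closure_of by blast
  have "shift h y u = (T u a \<in> U)" if "u \<in> K" for u
  proof -
    have "T (u * h) x \<in> B u"
      using h that ds x by (auto simp: V_def dynamical_system_def)
    then show ?thesis
      using joining_agrees_off_boundary[OF ds a U xy, of "u * h"]
      by (auto simp: B_def shift_def split: if_splits)
  qed
  then have "shift h y \<in> W" by (rule K(2))
  then show "\<exists>z. z \<in> range (\<lambda>g. shift g y) \<and> z \<in> W" by blast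
qed simp

section \<open>The two implications\<close>

lemma strongly_dynamically_syndetic_imp_minimal_furstenberg:
  fixes A :: "'g::monoid_mult set"
  assumes "strongly_dynamically_syndetic_via A X T"
  shows "has_minimal_furstenberg_system A"
proof -
  obtain a U where X: "minimal_system X T" and a: "a \<in> topspace X" and U: "openin X U"
    and A: "A = {g. T g a \<in> U}" and bd: "\<And>g. T g a \<notin> X closure_of U - U"
    using assms unfolding strongly_dynamically_syndetic_via_def by blast
  define y0 where "y0 = (\<lambda>u. T u a \<in> U)"
  let ?C = "shift_topology closure_of (range (\<lambda>g. shift g y0))"
  let ?Y = "subtopology shift_topology ?C"
  have Y: "dynamical_system ?Y shift" "transitive_point ?Y shift y0"
    using orbit_closure_system[OF dynamical_system_shift, of y0] by simp_all
  have "minimal_system ?Y shift"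
  proof (rule minimal_systemI[OF Y])
    fix y assume y: "y \<in> topspace ?Y"
    \<comment> \<open>Recurrence was shown in the full shift; since this orbit stays in
      \<open>?C\<close>, it carries over to the subspace closure.\<close>
    have "range (\<lambda>g. shift g y) \<subseteq> ?C"
      using dynamical_system_maps[OF Y(1) y] by auto
    moreover have "y0 \<in> shift_topology closure_of (range (\<lambda>g. shift g y))"
      using strongly_dynamically_syndetic_via_imp_recurrent[OF X a U bd] y by (simp add: y0_def)
    moreover have "y0 \<in> ?C" using Y(2) by (simp add: transitive_point_def)
    ultimately show "y0 \<in> ?Y closure_of (range (\<lambda>g. shift g y))"
      by (simp add: closure_of_subtopology Int_absorb1)
  qed
  moreover have "furstenberg_system (indicator A) ?Y shift"
    using furstenberg_system_shift[of A] by (simp add: A y0_def)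
  ultimately show ?thesis
    using has_minimal_furstenberg_systemI unfolding minimal_furstenberg_system_of_set_def by blast
qed

lemma minimal_furstenberg_imp_strongly_dynamically_syndetic_via:
  fixes A :: "'g::monoid_mult set"
  assumes ne: "A \<noteq> {}" and "minimal_furstenberg_system_of_set A X T"
  shows "strongly_dynamically_syndetic_via A X T"
proof -
  have X: "minimal_system X T" and f: "furstenberg_system (indicator A) X T"
    using assms(2) by (auto simp: minimal_furstenberg_system_of_set_def)
  obtain F a where F: "continuous_map X (euclidean :: complex topology) F"
    and a: "transitive_point X T a" and val: "\<And>g. indicator A g = F (T g a)"
    using f unfolding furstenberg_system_def by blast
  have aX: "a \<in> topspace X" using a by (simp add: transitive_point_def)
  have Ta: "T g a \<in> topspace X" for g
    using X aX dynamical_system_maps by (auto simp: minimal_system_def)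
  have "closedin X {x \<in> topspace X. F x \<in> {0, 1}}"
    by (rule closedin_continuous_map_preimage[OF F]) simp
  moreover have "F (T g a) \<in> {0, 1}" for g
    using val[of g] by (cases "g \<in> A") auto
  ultimately have "X closure_of (range (\<lambda>g. T g a)) \<subseteq> {x \<in> topspace X. F x \<in> {0, 1}}"
    using Ta by (intro closure_of_minimal) auto
  then have F01: "F x = 0 \<or> F x = 1" if "x \<in> topspace X" for x
    using a that by (auto simp: transitive_point_def)
  define U where "U = {x \<in> topspace X. F x \<in> {1}}"
  have "closedin X U"
    unfolding U_def by (rule closedin_continuous_map_preimage[OF F]) simp
  then have cl: "X closure_of U = U" by (rule closure_of_closedin)
  \<comment> \<open>With only the values 0 and 1, \<open>U\<close> is also the preimage of an open
    set; being clopen, it has empty boundary.\<close>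
  have "U = {x \<in> topspace X. F x \<in> - {0}}" using F01 by (auto simp: U_def)
  then have op: "openin X U"
    using openin_continuous_map_preimage[OF F, of "- {0}"] by (simp add: open_Compl)
  have A: "A = {g. T g a \<in> U}"
    using Ta by (simp add: U_def val[symmetric] indicator_eq_1_iff)
  \<comment> \<open>For empty \<open>A\<close>, density of the orbit would make \<open>F\<close>
    vanish identically and \<open>U\<close> empty.\<close>
  with ne have "U \<noteq> {}" by auto
  then show ?thesis
    unfolding strongly_dynamically_syndetic_via_def
    using X aX op A cl by blast
qed

theorem theorem4p5:
  fixes A :: "'g::monoid_mult set"
  assumes "A \<noteq> {}"
  shows "has_minimal_furstenberg_system A \<longleftrightarrow> strongly_dynamically_syndetic A"
  using assms minimal_furstenberg_imp_strongly_dynamically_syndetic_via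
    strongly_dynamically_syndetic_imp_minimal_furstenberg
  unfolding has_minimal_furstenberg_system_def strongly_dynamically_syndetic_def by metis

end
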